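(* Let $\Delta\neq\mathbb{N}$ be a numerical semigroup, let $d\ge2$ be an integer, and let $a\in\Delta\setminus\{0\}$ with $a+1\in\Delta$. Set $$\Delta_d(a)=d\Delta\,\cup\,\bigcup_{i=1}^{d-1}(da+i+d\Delta).$$ Then $\Delta_d(a)$ is a numerical semigroup and $\Delta_d(a)/d=\Delta$. Moreover, if $\{n_1,\dots,n_e\}$ is the minimal system of generators of $\Delta$, then $$\Delta_d(a)=\langle dn_1,\dots,dn_e,\ da+1,\dots,da+d-1\rangle.$$ In particular, $\Delta_d(a)$ is a multiple of $\Delta$.
   Context: $\mathbb{N}=\{0,1,2,\dots\}$. A numerical semigroup is a submonoid of $(\mathbb{N},+)$ with finite complement in $\mathbb{N}$; each has a unique minimal system of generators. For $A\subseteq\mathbb{N}$ and $d\ge1$, $A/d=\{x\in\mathbb{N}: dx\in A\}$ and $dA=\{dx: x\in A\}$; $k+A=\{k+x:x\in A\}$ for $k\in\mathbb{N}$. $\langle X\rangle$ denotes the submonoid of $(\mathbb{N},+)$ generated by $X$. A numerical semigroup $T$ is a multiple of a numerical semigroup $S$ if $T/k=S$ for some integer $k\ge1$. *)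

theory Defs
  imports Complex_Main "HOL-Library.Set_Algebras"
begin

definition nat_submonoid :: "nat set \<Rightarrow> bool" where
  "nat_submonoid S \<longleftrightarrow> 0 \<in> S \<and> (\<forall>x\<in>S. \<forall>y\<in>S. x + y \<in> S)"

definition numerical_semigroup :: "nat set \<Rightarrow> bool" where
  "numerical_semigroup S \<longleftrightarrow> nat_submonoid S \<and> finite (- S)"

definition generated :: "nat set \<Rightarrow> nat set" where
  "generated X = nat_submonoid hull X"

text \<open>Minimality is with respect to inclusion. Existence, uniqueness and finiteness of
  such a system are proved in \<open>ex1_minimal_generators\<close> and
  \<open>finite_minimal_generators\<close> below.\<close>

definition minimal_generators :: "nat set \<Rightarrow> nat set \<Rightarrow> bool" where
  "minimal_generators N S \<longleftrightarrow> generated N = S \<and> (\<forall>Y. Y \<subset> N \<longrightarrow> generated Y \<noteq> S)"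

definition quotient_by :: "nat set \<Rightarrow> nat \<Rightarrow> nat set" where
  "quotient_by A d = {x. d * x \<in> A}"

definition is_multiple_of :: "nat set \<Rightarrow> nat set \<Rightarrow> bool" where
  "is_multiple_of T S \<longleftrightarrow>
     numerical_semigroup T \<and> numerical_semigroup S \<and> (\<exists>k\<ge>1. quotient_by T k = S)"

text \<open>In \<^theory>\<open>HOL-Library.Set_Algebras\<close>, \<open>d *o A\<close> is the set of all \<open>d * x\<close> and
  \<open>k +o A\<close> the set of all \<open>k + x\<close> with \<open>x \<in> A\<close>.\<close>

definition semigroup_multiple :: "nat set \<Rightarrow> nat \<Rightarrow> nat \<Rightarrow> nat set" where
  "semigroup_multiple \<Delta> d a =
     (d *o \<Delta>) \<union> (\<Union>i\<in>{1..d - 1}. (d * a + i) +o (d *o \<Delta>))"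

lemma nat_submonoid_generated: "nat_submonoid (generated X)"
  unfolding generated_def by (rule hull_in) (auto simp: nat_submonoid_def)

lemma generated_minimal: "X \<subseteq> T \<Longrightarrow> nat_submonoid T \<Longrightarrow> generated X \<subseteq> T"
  unfolding generated_def by (rule hull_minimal)

lemma subset_generated: "X \<subseteq> generated X"
  unfolding generated_def by (rule hull_subset)

definition atoms :: "nat set \<Rightarrow> nat set" where
  "atoms S = {x \<in> S. x \<noteq> 0 \<and> \<not> (\<exists>y\<in>S. \<exists>z\<in>S. y \<noteq> 0 \<and> z \<noteq> 0 \<and> x = y + z)}"

lemma generated_atoms:
  assumes "nat_submonoid S"
  shows "generated (atoms S) = S"
proof
  show "generated (atoms S) \<subseteq> S"
    using assms by (intro generated_minimal) (auto simp: atoms_def)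
  have "x \<in> generated (atoms S)" if "x \<in> S" for x
    using that
  proof (induction x rule: less_induct)
    case (less x)
    consider "x = 0" | "x \<in> atoms S"
      | y z where "y \<in> S" "z \<in> S" "y \<noteq> 0" "z \<noteq> 0" "x = y + z"
      using less.prems by (auto simp: atoms_def)
    then show ?case
    proof cases
      case 1
      then show ?thesis using nat_submonoid_generated by (auto simp: nat_submonoid_def)
    next
      case 2
      then show ?thesis using subset_generated by blast
    next
      case 3
      then have "y \<in> generated (atoms S)" "z \<in> generated (atoms S)"
        using less.IH by auto
      then show ?thesis
        using 3 nat_submonoid_generated[of "atoms S"] by (simp add: nat_submonoid_def)
    qed
  qed
  then show "S \<subseteq> generated (atoms S)" by blast
qed

lemma atoms_subset_generators:
  assumes "nat_submonoid S" "generated Y = S"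
  shows "atoms S \<subseteq> Y"
proof (rule ccontr)
  assume "\<not> atoms S \<subseteq> Y"
  then obtain x where x: "x \<in> atoms S" "x \<notin> Y" by blast
  have "nat_submonoid (S - {x})"
    unfolding nat_submonoid_def
  proof (intro conjI ballI)
    show "0 \<in> S - {x}"
      using assms(1) x(1) by (simp add: nat_submonoid_def atoms_def)
    fix y z assume yz: "y \<in> S - {x}" "z \<in> S - {x}"
    then have "y + z \<in> S" using assms(1) by (simp add: nat_submonoid_def)
    moreover have "y + z \<noteq> x"
    proof (cases "y = 0 \<or> z = 0")
      case True
      then show ?thesis using yz by auto
    next
      case False
      then show ?thesis using x(1) yz by (auto simp: atoms_def)
    qed
    ultimately show "y + z \<in> S - {x}" by simp
  qed
  moreover have "Y \<subseteq> S - {x}"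
    using subset_generated[of Y] assms(2) x(2) by blast
  ultimately have "S \<subseteq> S - {x}"
    using generated_minimal assms(2) by blast
  then show False using x(1) by (auto simp: atoms_def)
qed

lemma minimal_generators_iff_atoms:
  assumes "nat_submonoid S"
  shows "minimal_generators N S \<longleftrightarrow> N = atoms S"
  using generated_atoms[OF assms] atoms_subset_generators[OF assms]
  unfolding minimal_generators_def by blast

lemma ex1_minimal_generators:
  "numerical_semigroup S \<Longrightarrow> \<exists>!N. minimal_generators N S"
  by (simp add: numerical_semigroup_def minimal_generators_iff_atoms)

lemma finite_minimal_generators:
  assumes "numerical_semigroup S" "minimal_generators N S"
  shows "finite N"
proof -
  have S: "nat_submonoid S" and "finite (- S)"
    using assms(1) by (auto simp: numerical_semigroup_def)
  then have "infinite S"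
    using finite_compl infinite_UNIV_nat by blast
  then have "\<not> S \<subseteq> {0}" using finite_subset by blast
  then obtain m where m: "m \<in> S" "m > 0" by auto
  have mult: "k * m \<in> S" for k
    using S m by (induction k) (auto simp: nat_submonoid_def)
  have *: "\<not> x < y" if "x \<in> atoms S" "y \<in> atoms S" "x mod m = y mod m" for x y
  proof
    assume "x < y"
    then have "m dvd y - x"
      using that(3) mod_eq_dvd_iff_nat[of x y m] by simp
    then obtain k where k: "y - x = k * m"
      by (metis dvd_def mult.commute)
    then have "y = x + k * m" "k * m \<noteq> 0" using \<open>x < y\<close> by linarith+
    then show False using that(1,2) mult[of k] unfolding atoms_def by blast
  qed
  have "inj_on (\<lambda>x. x mod m) (atoms S)"
  proof (rule inj_onI)
    fix x y assume "x \<in> atoms S" "y \<in> atoms S" "x mod m = y mod m"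
    then show "x = y" using *[of x y] *[of y x] by linarith
  qed
  moreover have "(\<lambda>x. x mod m) ` atoms S \<subseteq> {..<m}" using m by auto
  ultimately have "finite (atoms S)" using finite_lessThan inj_on_finite by blast
  then show ?thesis using assms(2) minimal_generators_iff_atoms[OF S] by simp
qed

end

theory Submission
  imports Defs
begin

text \<open>Adding two elements of \<open>\<Delta>\<^sub>d(a)\<close> with nonzero residues \<open>i\<close> and \<open>j\<close> modulo \<open>d\<close> leaves a surplus \<open>a\<close>
  in the quotient if \<open>i + j < d\<close>, a surplus \<open>a + 1\<close> if \<open>i + j > d\<close>, and
  \<open>a + (a + 1)\<close> if \<open>i + j = d\<close>. Both \<open>a\<close> and \<open>a + 1\<close> lie in \<open>\<Delta>\<close>, so the sum stays in the set.\<close>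

text \<open>This is division with remainder by \<open>d\<close>: an element is known by its residue
  \<open>i\<close> and its quotient, and a nonzero residue requires the quotient to exceed an
  element of \<Delta> by exactly \<open>a\<close>.\<close>

lemma mem_semigroup_multiple:
  "n \<in> semigroup_multiple \<Delta> d a \<longleftrightarrow>
     (\<exists>x\<in>\<Delta>. n = d * x) \<or> (\<exists>x\<in>\<Delta>. \<exists>i. 0 < i \<and> i < d \<and> n = d * (a + x) + i)"
proof -
  have "i \<in> {1..d - 1} \<longleftrightarrow> 0 < i \<and> i < d" for i by auto
  then show ?thesis
    unfolding semigroup_multiple_def elt_set_plus_def elt_set_times_def
    by (simp add: algebra_simps Bex_def) blast
qed

lemma nat_submonoid_semigroup_multiple:
  assumes "nat_submonoid \<Delta>" "a \<in> \<Delta>" "a + 1 \<in> \<Delta>"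
  shows "nat_submonoid (semigroup_multiple \<Delta> d a)"
proof -
  have zero: "0 \<in> \<Delta>" and add: "\<And>x y. x \<in> \<Delta> \<Longrightarrow> y \<in> \<Delta> \<Longrightarrow> x + y \<in> \<Delta>"
    using assms(1) by (auto simp: nat_submonoid_def)
  let ?T = "semigroup_multiple \<Delta> d a"
  have multI: "d * x \<in> ?T" if "x \<in> \<Delta>" for x
    using that mem_semigroup_multiple by blast
  have shiftI: "d * (a + x) + i \<in> ?T" if "x \<in> \<Delta>" "0 < i" "i < d" for x i
    using that mem_semigroup_multiple by blast
  have mult_shift: "d * x + (d * (a + y) + i) \<in> ?T"
    if "x \<in> \<Delta>" "y \<in> \<Delta>" "0 < i" "i < d" for x y i
    using shiftI[OF add[OF that(1,2)] that(3,4)] by (simp add: algebra_simps)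
  have shift_shift: "(d * (a + x) + i) + (d * (a + y) + j) \<in> ?T"
    if x: "x \<in> \<Delta>" and y: "y \<in> \<Delta>" and i: "0 < i" "i < d" and j: "0 < j" "j < d" for x y i j
  proof -
    note xy = add[OF x y]
    \<comment> \<open>In the last case \<open>k\<close> is the residue left after the carry; it
      stays below \<open>d\<close> because \<open>i\<close> and \<open>j\<close> do.\<close>
    consider "i + j < d" | "i + j = d" | k where "i + j = d + k" "0 < k" "k < d"
      using i j by (metis add_less_mono less_imp_add_positive linorder_neqE_nat nat_add_left_cancel_less)
    then show ?thesis
    proof cases
      \<comment> \<open>There is no carry: one \<open>a\<close> remains as the shift, the other
        joins \<open>x + y\<close> inside \<Delta>.\<close>
      case 1
      then show ?thesis
        using shiftI[OF add[OF assms(2) xy], of "i + j"] i by (simp add: algebra_simps)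
    next
      case 2
      have "(d * (a + x) + i) + (d * (a + y) + j) = d * (a + x + (a + y)) + (i + j)"
        by (simp add: algebra_simps)
      also have "\<dots> = d * (a + (a + 1 + (x + y)))"
        using 2 by (simp add: algebra_simps)
      finally show ?thesis
        using multI[OF add[OF assms(2) add[OF assms(3) xy]]] by simp
    next
      case 3
      have "(d * (a + x) + i) + (d * (a + y) + j) = d * (a + x + (a + y)) + (i + j)"
        by (simp add: algebra_simps)
      \<comment> \<open>The carry adds 1 to the quotient. One \<open>a\<close> remains as the shift,
        and \<open>a + 1\<close> is absorbed into \<Delta>.\<close>
      also have "\<dots> = d * (a + (a + 1 + (x + y))) + k"
        using 3 by (simp add: algebra_simps)
      finally show ?thesis
        using shiftI[OF add[OF assms(3) xy] 3(2,3)] by simp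
    qed
  qed
  have "u + v \<in> ?T" if uv: "u \<in> ?T" "v \<in> ?T" for u v
  proof -
    from uv(1) consider x where "x \<in> \<Delta>" "u = d * x"
      | x i where "x \<in> \<Delta>" "0 < i" "i < d" "u = d * (a + x) + i"
      unfolding mem_semigroup_multiple by blast
    note u = this
    from uv(2) consider y where "y \<in> \<Delta>" "v = d * y"
      | y j where "y \<in> \<Delta>" "0 < j" "j < d" "v = d * (a + y) + j"
      unfolding mem_semigroup_multiple by blast
    note v = this
    show ?thesis
    proof (cases rule: u)
      case u: (1 x)
      show ?thesis
      proof (cases rule: v)
        case (1 y)
        then show ?thesis using u multI[OF add, of x y] by (simp add: distrib_left)
      next
        case (2 y j)
        then show ?thesis using u mult_shift[of x y j] by simp
      qed
    next
      case u: (2 x i)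
      show ?thesis
      proof (cases rule: v)
        case (1 y)
        then show ?thesis using u mult_shift[of y x i] by (simp add: add.commute)
      next
        case (2 y j)
        then show ?thesis using u shift_shift[of x y i j] by simp
      qed
    qed
  qed
  then show ?thesis
    using multI[OF zero] by (simp add: nat_submonoid_def)
qed

text \<open>Once the quotient \<open>n div d\<close> is large, both it and
  \<open>n div d - a\<close> lie beyond all gaps of \<Delta>. The first settles residue 0, the
  second every other residue.\<close>

lemma finite_compl_semigroup_multiple:
  assumes "finite (- \<Delta>)" "d > 0"
  shows "finite (- semigroup_multiple \<Delta> d a)"
proof -
  obtain m where m: "\<And>x. x \<notin> \<Delta> \<Longrightarrow> x < m"
    using assms(1) unfolding finite_nat_set_iff_bounded by auto
  \<comment> \<open>From \<open>m\<close> on, everything lies in \<Delta>. The extra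
    \<open>a\<close> in the bound keeps the quotient at least \<open>m\<close> after subtracting the
    shift.\<close>
  have "n \<in> semigroup_multiple \<Delta> d a" if "n \<ge> d * (a + m)" for n
  proof -
    have q: "n div d \<ge> a + m"
      using that assms(2) by (simp add: less_eq_div_iff_mult_less_eq mult.commute)
    then have "n div d \<in> \<Delta>" "n div d - a \<in> \<Delta>"
      using m by fastforce+
    moreover have "n = d * (n div d) + n mod d" "a + (n div d - a) = n div d" "n mod d < d"
      using q assms(2) by auto
    ultimately show ?thesis
      unfolding mem_semigroup_multiple by (metis add.right_neutral neq0_conv)
  qed
  then have "- semigroup_multiple \<Delta> d a \<subseteq> {..<d * (a + m)}"
    by (meson ComplD lessThan_iff not_le subsetI)
  then show ?thesis
    using finite_subset by blast
qed

text \<open>The shifted elements have nonzero residue modulo \<open>d\<close>, so multiples of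
  \<open>d\<close> can come only from \<open>d *o \<Delta>\<close>, where \<open>d\<close>
  cancels.\<close>

lemma quotient_by_semigroup_multiple:
  assumes "d > 0"
  shows "quotient_by (semigroup_multiple \<Delta> d a) d = \<Delta>"
proof -
  have "d * x \<noteq> d * y + i" if "0 < i" "i < d" for x y i
  proof
    assume "d * x = d * y + i"
    then have "(d * x) mod d = (d * y + i) mod d" by simp
    then show False using that by simp
  qed
  then show ?thesis
    using assms by (auto simp: quotient_by_def mem_semigroup_multiple)
qed

lemma generated_semigroup_multiple:
  assumes "nat_submonoid (semigroup_multiple \<Delta> d a)" "generated N = \<Delta>"
  shows "generated ((d *o N) \<union> {d * a + 1 .. d * a + d - 1}) = semigroup_multiple \<Delta> d a"
    (is "generated ?X = ?T")
proof
  have N: "N \<subseteq> \<Delta>" and "0 \<in> \<Delta>"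
    using assms(2) subset_generated nat_submonoid_generated[of N]
    by (auto simp: nat_submonoid_def)
  have "n \<in> ?T" if "n \<in> {d * a + 1 .. d * a + d - 1}" for n
  proof -
    \<comment> \<open>The new generators are the shifted elements with \<open>x = 0\<close>.\<close>
    have "0 < n - d * a" "n - d * a < d" "n = d * (a + 0) + (n - d * a)"
      using that by auto
    then show ?thesis
      using \<open>0 \<in> \<Delta>\<close> unfolding mem_semigroup_multiple by blast
  qed
  moreover have "d *o N \<subseteq> ?T"
    using N by (auto simp: semigroup_multiple_def elt_set_times_def)
  ultimately have "?X \<subseteq> ?T"
    by blast
  then show "generated ?X \<subseteq> ?T"
    using assms(1) by (rule generated_minimal)
next
  have G: "nat_submonoid (generated ?X)"
    by (rule nat_submonoid_generated)
  \<comment> \<open>Division by \<open>d\<close> preserves submonoids, so minimality of the hull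
    carries the inclusion from \<open>N\<close> to all of \<Delta>, in place of an induction over
    sums of generators.\<close>
  have "generated N \<subseteq> quotient_by (generated ?X) d"
  proof (rule generated_minimal)
    show "N \<subseteq> quotient_by (generated ?X) d"
      using subset_generated[of ?X] by (auto simp: quotient_by_def elt_set_times_def)
    show "nat_submonoid (quotient_by (generated ?X) d)"
      using G by (simp add: nat_submonoid_def quotient_by_def distrib_left)
  qed
  then have mult: "d * x \<in> generated ?X" if "x \<in> \<Delta>" for x
    using that assms(2) by (auto simp: quotient_by_def)
  have "d * (a + x) + i \<in> generated ?X" if "x \<in> \<Delta>" "0 < i" "i < d" for x i
  proof -
    have "d * a + i \<in> ?X" using that by auto
    then have "d * a + i \<in> generated ?X"
      using subset_generated by (rule rev_subsetD)
    \<comment> \<open>A shifted element is one new generator plus an element of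
      \<open>d *o \<Delta>\<close>.\<close>
    then have "d * a + i + d * x \<in> generated ?X"
      using G mult[OF that(1)] by (simp add: nat_submonoid_def)
    then show ?thesis by (simp add: algebra_simps)
  qed
  then show "?T \<subseteq> generated ?X"
    using mult by (auto simp: mem_semigroup_multiple)
qed

theorem theorem3p1:
  fixes \<Delta> :: "nat set" and d a :: nat
  assumes "numerical_semigroup \<Delta>" and "\<Delta> \<noteq> UNIV"
    and "d \<ge> 2"
    and "a \<in> \<Delta> - {0}" and "a + 1 \<in> \<Delta>"
  shows "numerical_semigroup (semigroup_multiple \<Delta> d a)
    \<and> quotient_by (semigroup_multiple \<Delta> d a) d = \<Delta>
    \<and> (\<forall>N. minimal_generators N \<Delta> \<longrightarrow>
          semigroup_multiple \<Delta> d a = generated ((d *o N) \<union> {d * a + 1 .. d * a + d - 1}))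
    \<and> is_multiple_of (semigroup_multiple \<Delta> d a) \<Delta>"
proof -
  let ?T = "semigroup_multiple \<Delta> d a"
  have submonoid: "nat_submonoid ?T"
    using assms by (intro nat_submonoid_semigroup_multiple) (auto simp: numerical_semigroup_def)
  then have num: "numerical_semigroup ?T"
    using assms finite_compl_semigroup_multiple by (simp add: numerical_semigroup_def)
  have quot: "quotient_by ?T d = \<Delta>"
    using assms(3) by (intro quotient_by_semigroup_multiple) simp
  have "is_multiple_of ?T \<Delta>"
    unfolding is_multiple_of_def using num quot assms(1,3) by (auto intro!: exI[of _ d])
  then show ?thesis
    using num quot generated_semigroup_multiple[OF submonoid]
    by (simp add: minimal_generators_def)
qed

end
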